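(* Let $G$ be a finite group. Then the following hold. (1) If $|cs_{npp}(G)|=n$ with $n\geq 3$ (i.e. exactly $n$ distinct class sizes of $G$ are not prime powers), then $|cs_{pp}(G)|\leq n$ (i.e. there are at most $n$ primes having a non-trivial power that is a class size of $G$). (2) If $|cs_{npp}(G)|=2$, then $|cs_{pp}(G)|\leq 3$. (3) If $|cs_{npp}(G)|=1$, then $|cs_{pp}(G)|\leq 2$.
   Context: For a finite group $G$, $cs(G)=\{|x^G| : x\in G\}$ is the set of conjugacy class sizes of $G$ (a set, so each size is counted once). $cs_{npp}(G)$ is the subset of $cs(G)$ consisting of those class sizes that are not prime powers, where $1$ is regarded as a (trivial) prime power; so $cs_{npp}(G)$ consists of the class sizes divisible by at least two distinct primes. $cs_{pp}(G)$ is the set of distinct primes $p$ for which some power $p^a$ with $a\geq 1$ belongs to $cs(G)$. *)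

theory Defs
  imports "HOL-Algebra.Group_Action" "HOL-Number_Theory.Prime_Powers"
begin

definition conj_class :: "('a, 'b) monoid_scheme \<Rightarrow> 'a \<Rightarrow> 'a set" where
  "conj_class G x =
     orbit G (\<lambda>g. \<lambda>h \<in> carrier G. g \<otimes>\<^bsub>G\<^esub> h \<otimes>\<^bsub>G\<^esub> inv\<^bsub>G\<^esub> g) x"

definition cs :: "('a, 'b) monoid_scheme \<Rightarrow> nat set" where
  "cs G = (\<lambda>x. card (conj_class G x)) ` carrier G"

(* primepow 1 is false in the library, but 1 counts as a trivial prime power here,
   so it has to be excluded separately. *)
definition cs_npp :: "('a, 'b) monoid_scheme \<Rightarrow> nat set" where
  "cs_npp G = {n \<in> cs G. n \<noteq> 1 \<and> \<not> primepow n}"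

definition cs_pp :: "('a, 'b) monoid_scheme \<Rightarrow> nat set" where
  "cs_pp G = {p. prime p \<and> (\<exists>a\<ge>1. p ^ a \<in> cs G)}"

end

theory Submission
  imports Defs "HOL-Algebra.Sylow" "HOL-Algebra.Multiplicative_Group"
begin

text \<open>To each prime \<open>p\<close> in \<open>cs_pp G\<close> corresponds an element \<open>x\<^sub>p\<close> whose class size is a nontrivial power of
\<open>p\<close>. Replacing it by a suitable power, its order can be taken to be a power of some prime \<open>f p\<close>
(\<open>cs_pp_primary\<close>). For two primes \<open>p \<noteq> q\<close> the product of suitable conjugates of \<open>x\<^sub>p\<close> and \<open>x\<^sub>q\<close>
is a natural candidate for an element whose class size has exactly the prime divisors \<open>p\<close> and \<open>q\<close>, and
different pairs would then give different members of \<open>cs_npp G\<close>. Because the two class sizes are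
coprime, all products of conjugates are conjugate to each other and their class size divides the product
of the two class sizes; the question is whether both primes survive.

Two arguments show that they do. If the orders of the two elements are coprime and one of the elements can be
moved by conjugation to commute with the other, both are powers of their product
(\<open>mult_coprime_orders\<close>). If \<open>f p \<noteq> q\<close> and \<open>f q \<noteq> p\<close>, the loss of a prime would force a
normal \<open>p\<close>- or \<open>q\<close>-subgroup that makes one of the elements central (\<open>class_size_mult_not_dvd\<close>).
Together they cover all pairs except those with \<open>f p = q\<close> and \<open>f q = p\<close>, and those with
\<open>f p = f q \<in> {p, q}\<close>.

The exceptional pairs are sparse (\<open>few_exceptional_pairs\<close>): among \<open>k \<ge> 3\<close> primes there are at most
\<open>k - 2\<close> of them, unless \<open>f\<close> is constant with value one of the primes, when there are \<open>k - 1\<close>. In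
the latter case a further class size that is not a prime power, divisible by this value, comes from an element of
another prime power order (\<open>exists_class_size_divisible_by_star_centre\<close>). So \<open>card (cs_npp G)\<close> is at
least \<open>(k choose 2) - (k - 2)\<close> for all \<open>k \<ge> 3\<close>, which contains the three claims.\<close>

section \<open>Conjugation in a finite group\<close>

locale finite_group = group G for G (structure) +
  assumes finite_carrier [simp, intro]: "finite (carrier G)"
begin

abbreviation cj :: "'a \<Rightarrow> 'a \<Rightarrow> 'a" where
  "cj g x \<equiv> g \<otimes> x \<otimes> inv g"

abbreviation class_size :: "'a \<Rightarrow> nat" where
  "class_size x \<equiv> card (conj_class G x)"

definition centralizer :: "'a \<Rightarrow> 'a set" where
  "centralizer x = {g \<in> carrier G. g \<otimes> x = x \<otimes> g}"

lemma conj_class_eq: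
  assumes "x \<in> carrier G"
  shows "conj_class G x = (\<lambda>g. cj g x) ` carrier G"
  using assms by (auto simp: conj_class_def orbit_def)

lemma conj_class_subset: "x \<in> carrier G \<Longrightarrow> conj_class G x \<subseteq> carrier G"
  by (auto simp: conj_class_eq)

lemma cj_in_class: "x \<in> carrier G \<Longrightarrow> g \<in> carrier G \<Longrightarrow> cj g x \<in> conj_class G x"
  by (auto simp: conj_class_eq)

lemma self_in_class: "x \<in> carrier G \<Longrightarrow> x \<in> conj_class G x"
  using cj_in_class[of x \<one>] by simp

lemma finite_class: "x \<in> carrier G \<Longrightarrow> finite (conj_class G x)"
  by (simp add: conj_class_eq)

lemma class_size_pos: "x \<in> carrier G \<Longrightarrow> class_size x > 0"
  using self_in_class finite_class card_gt_0_iff by blast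

lemma inv_mult_cancel [simp]:
  assumes "g \<in> carrier G" "x \<in> carrier G"
  shows "inv g \<otimes> (g \<otimes> x) = x" "g \<otimes> (inv g \<otimes> x) = x"
  using assms by (simp_all add: m_assoc[symmetric])

lemma cj_cj: "\<lbrakk>x \<in> carrier G; g \<in> carrier G; h \<in> carrier G\<rbrakk> \<Longrightarrow> cj g (cj h x) = cj (g \<otimes> h) x"
  by (simp add: inv_mult_group m_assoc)

lemma cj_mult: "\<lbrakk>x \<in> carrier G; y \<in> carrier G; g \<in> carrier G\<rbrakk> \<Longrightarrow> cj g (x \<otimes> y) = cj g x \<otimes> cj g y"
  by (simp add: m_assoc)

lemma cj_pow:
  assumes "x \<in> carrier G" "g \<in> carrier G"
  shows "cj g x [^] (n::nat) = cj g (x [^] n)"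
proof (induction n)
  case (Suc n)
  then show ?case using assms cj_mult by simp
qed (use assms in simp)

lemma class_cj:
  assumes x: "x \<in> carrier G" and g: "g \<in> carrier G"
  shows "conj_class G (cj g x) = conj_class G x"
proof (intro equalityI subsetI)
  fix z assume "z \<in> conj_class G (cj g x)"
  then show "z \<in> conj_class G x" using x g by (auto simp: conj_class_eq cj_cj)
next
  fix z assume "z \<in> conj_class G x"
  then obtain h where h: "h \<in> carrier G" "z = cj h x" using x by (auto simp: conj_class_eq)
  have "z = cj (h \<otimes> inv g) (cj g x)" using x g h by (simp add: cj_cj inv_mult_group m_assoc)
  then show "z \<in> conj_class G (cj g x)" using x g h by (auto simp: conj_class_eq)
qed

lemma class_size_mult_commute:
  assumes "x \<in> carrier G" "y \<in> carrier G"
  shows "class_size (x \<otimes> y) = class_size (y \<otimes> x)"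
proof -
  have "y \<otimes> x = cj y (x \<otimes> y)" using assms by (simp add: m_assoc)
  then show ?thesis using class_cj[of "x \<otimes> y" y] assms by simp
qed

lemma commutes_inv:
  assumes "g \<otimes> x = x \<otimes> g" "g \<in> carrier G" "x \<in> carrier G"
  shows "inv g \<otimes> x = x \<otimes> inv g"
proof -
  have "inv g \<otimes> x = inv g \<otimes> (x \<otimes> g) \<otimes> inv g" using assms by (simp add: m_assoc)
  also have "\<dots> = x \<otimes> inv g" using assms by (simp flip: assms(1) add: m_assoc)
  finally show ?thesis .
qed

lemma subgroup_centralizer:
  assumes "x \<in> carrier G"
  shows "subgroup (centralizer x) G"
proof (rule subgroupI)
  show "centralizer x \<noteq> {}" using assms by (auto simp: centralizer_def intro!: exI[of _ \<one>])
  show "inv a \<in> centralizer x" if "a \<in> centralizer x" for a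
    using that assms by (simp add: centralizer_def commutes_inv)
  show "a \<otimes> b \<in> centralizer x" if "a \<in> centralizer x" "b \<in> centralizer x" for a b
  proof -
    have ab: "a \<in> carrier G" "b \<in> carrier G" "a \<otimes> x = x \<otimes> a" "b \<otimes> x = x \<otimes> b"
      using that by (auto simp: centralizer_def)
    have "a \<otimes> b \<otimes> x = a \<otimes> x \<otimes> b" using ab(1,2,4) assms by (simp add: m_assoc)
    also have "\<dots> = x \<otimes> (a \<otimes> b)" using ab assms by (simp add: m_assoc)
    finally show ?thesis using ab by (simp add: centralizer_def)
  qed
qed (auto simp: centralizer_def)

lemma cj_eq_iff:
  assumes "x \<in> carrier G" "g \<in> carrier G" "h \<in> carrier G"
  shows "cj g x = cj h x \<longleftrightarrow> inv h \<otimes> g \<in> centralizer x"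
proof -
  have "cj g x = cj h x \<longleftrightarrow> g \<otimes> x = cj h x \<otimes> g"
    using assms inv_solve_right'[of "cj h x" "g \<otimes> x" g] by auto
  also have "\<dots> \<longleftrightarrow> g \<otimes> x = h \<otimes> (x \<otimes> (inv h \<otimes> g))"
    using assms by (simp add: m_assoc)
  also have "\<dots> \<longleftrightarrow> inv h \<otimes> (g \<otimes> x) = x \<otimes> (inv h \<otimes> g)" (is "?l = h \<otimes> ?r \<longleftrightarrow> _")
  proof
    assume "?l = h \<otimes> ?r"
    then show "inv h \<otimes> ?l = ?r" using assms by simp
  next
    assume "inv h \<otimes> ?l = ?r"
    then have "h \<otimes> (inv h \<otimes> ?l) = h \<otimes> ?r" by simp
    then show "?l = h \<otimes> ?r" using assms by (simp del: m_assoc)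
  qed
  finally show ?thesis using assms by (simp add: centralizer_def m_assoc)
qed

section \<open>Centralizers and class sizes\<close>

text \<open>The counting behind the orbit-stabilizer theorem: the fibres of \<open>f\<close> on \<open>H\<close> are the left
cosets of \<open>S\<close>. It is applied to orbits of the whole group, to orbits of pairs of elements, and to
orbits of a subgroup acting by conjugation.\<close>

lemma card_image_times_fibre_subgroup:
  assumes H: "subgroup H G" and S: "subgroup S G" "S \<subseteq> H"
    and f: "\<And>g h. \<lbrakk>g \<in> H; h \<in> H\<rbrakk> \<Longrightarrow> f g = f h \<longleftrightarrow> inv h \<otimes> g \<in> S"
  shows "card (f ` H) * card S = card H"
proof -
  note Hc = subgroup.mem_carrier[OF H] subgroup.m_closed[OF H] subgroup.m_inv_closed[OF H]
  have fin: "finite H" using H finite_subset[OF subgroup.subset finite_carrier] by blast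
  have fib: "card {g \<in> H. f g = b} = card S" if "b \<in> f ` H" for b
  proof -
    from that obtain h where h: "h \<in> H" "b = f h" by auto
    have "bij_betw (\<lambda>s. h \<otimes> s) S {g \<in> H. f g = b}"
    proof (rule bij_betw_byWitness[where f' = "\<lambda>g. inv h \<otimes> g"])
      show "(\<otimes>) h ` S \<subseteq> {g \<in> H. f g = b}"
        using h f S Hc by (auto simp: subset_iff)
      show "\<forall>s\<in>S. inv h \<otimes> (h \<otimes> s) = s" "\<forall>g\<in>{g \<in> H. f g = b}. h \<otimes> (inv h \<otimes> g) = g"
        using h S Hc by (auto simp: subset_iff)
      show "(\<otimes>) (inv h) ` {g \<in> H. f g = b} \<subseteq> S" using h f by auto
    qed
    then show ?thesis by (simp add: bij_betw_same_card)
  qed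
  have "card H = (\<Sum>g\<in>H. 1)" by simp
  also have "\<dots> = (\<Sum>b\<in>f ` H. \<Sum>g\<in>{g \<in> H. f g = b}. 1)"
    by (rule sum.image_gen) (rule fin)
  also have "\<dots> = (\<Sum>b\<in>f ` H. card S)" using fib by simp
  finally show ?thesis by simp
qed

lemma class_size_times_centralizer:
  assumes "x \<in> carrier G"
  shows "class_size x * card (centralizer x) = order G"
  unfolding conj_class_eq[OF assms] order_def
  using subgroup_self subgroup_centralizer[OF assms] subgroup.subset[OF subgroup_centralizer[OF assms]]
    cj_eq_iff[OF assms]
  by (rule card_image_times_fibre_subgroup)

lemma card_subgroup_dvd:
  assumes "subgroup H G" "subgroup K G" "H \<subseteq> K"
  shows "card H dvd card K"
proof -
  have "subgroup H (G\<lparr>carrier := K\<rparr>)" using assms by (simp add: subgroup_incl)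
  moreover have "group (G\<lparr>carrier := K\<rparr>)" using assms(2) by (simp add: subgroup.subgroup_is_group)
  ultimately have "card (rcosets\<^bsub>G\<lparr>carrier := K\<rparr>\<^esub> H) * card H = card K"
    using group.lagrange[of "G\<lparr>carrier := K\<rparr>" H] by (simp add: order_def)
  then show ?thesis by (metis dvd_triv_right)
qed

lemma card_subgroup_pos: "subgroup H G \<Longrightarrow> card H > 0"
  using subgroup.one_closed[of H G] finite_subset[OF subgroup.subset[of H G] finite_carrier]
  by (auto simp: card_gt_0_iff)

text \<open>Indices are multiplicative in towers. The indices enter as factors \<open>n\<close> and \<open>m\<close> of the group order
because class sizes arise in that form.\<close>

lemma index_dvd:
  assumes "subgroup H G" "subgroup K G" "H \<subseteq> K" "n * card H = order G" "m * card K = order G"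
  shows "m dvd n"
proof -
  obtain k where k: "card K = card H * k" using card_subgroup_dvd[OF assms(1-3)] by auto
  then have "n * card H = m * k * card H" using assms(4,5) by (simp add: ac_simps)
  then have "n = m * k" using card_subgroup_pos[OF assms(1)] by simp
  then show ?thesis by simp
qed

lemma class_size_dvd_if_centralizer_subset:
  assumes "x \<in> carrier G" "z \<in> carrier G" "centralizer x \<subseteq> centralizer z"
  shows "class_size z dvd class_size x"
  using index_dvd[OF subgroup_centralizer subgroup_centralizer] assms class_size_times_centralizer
  by blast

lemma class_size_eq_1_iff:
  assumes x: "x \<in> carrier G"
  shows "class_size x = 1 \<longleftrightarrow> centralizer x = carrier G"
proof
  assume "class_size x = 1"
  then have "card (centralizer x) = card (carrier G)"
    using class_size_times_centralizer[OF x] by (simp add: order_def)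
  then show "centralizer x = carrier G"
    by (intro card_subset_eq) (auto simp: centralizer_def)
next
  assume "centralizer x = carrier G"
  then have "class_size x * order G = 1 * order G"
    using class_size_times_centralizer[OF x] by (simp add: order_def)
  then show "class_size x = 1"
    using order_gt_0_iff_finite finite_carrier by (metis mult_right_cancel not_gr_zero)
qed

lemma pow_commutes:
  assumes "g \<otimes> x = x \<otimes> g" "g \<in> carrier G" "x \<in> carrier G"
  shows "g \<otimes> x [^] (n::nat) = x [^] n \<otimes> g"
proof (induction n)
  case (Suc n)
  have "g \<otimes> x [^] Suc n = g \<otimes> x [^] n \<otimes> x" using assms by (simp add: m_assoc)
  also have "\<dots> = x [^] n \<otimes> (g \<otimes> x)" using assms Suc by (simp add: m_assoc)
  finally show ?case using assms by (simp add: m_assoc)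
qed (use assms in simp)

lemma centralizer_pow: "x \<in> carrier G \<Longrightarrow> centralizer x \<subseteq> centralizer (x [^] (n::nat))"
  by (auto simp: centralizer_def pow_commutes)

lemma class_size_pow_dvd: "x \<in> carrier G \<Longrightarrow> class_size (x [^] (n::nat)) dvd class_size x"
  by (simp add: class_size_dvd_if_centralizer_subset centralizer_pow)

text \<open>By Bezout, \<open>x\<close> lies in the subgroup generated by \<open>x [^] u\<close> and \<open>x [^] v\<close>.\<close>

lemma centralizer_pow_coprime:
  assumes x: "x \<in> carrier G" and uv: "coprime u (v::nat)" "v \<noteq> 1"
  shows "centralizer (x [^] u) \<inter> centralizer (x [^] v) \<subseteq> centralizer x"
proof
  fix g assume g: "g \<in> centralizer (x [^] u) \<inter> centralizer (x [^] v)"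
  then have gc: "g \<in> carrier G" by (simp add: centralizer_def)
  obtain i j where ij: "u * i = v * j + 1" using coprime_bezout_strong[OF uv] by auto
  have 1: "g \<otimes> x [^] (u * i) = x [^] (u * i) \<otimes> g"
    and 2: "g \<otimes> x [^] (v * j) = x [^] (v * j) \<otimes> g"
    using g x by (auto simp: centralizer_def nat_pow_pow[symmetric] intro!: pow_commutes)
  define z where "z = x [^] (v * j)"
  have z: "z \<in> carrier G" using x by (simp add: z_def)
  have "x [^] (u * i) = z \<otimes> x" using x unfolding ij z_def by simp
  then have "g \<otimes> (z \<otimes> x) = z \<otimes> x \<otimes> g" "g \<otimes> z = z \<otimes> g" using 1 2 by (simp_all add: z_def)
  then have "z \<otimes> (g \<otimes> x) = z \<otimes> (x \<otimes> g)"
    using z x gc m_assoc[of g z x] m_assoc[of z g x] m_assoc[of z x g] by simp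
  then have "g \<otimes> x = x \<otimes> g" using z x gc by simp
  then show "g \<in> centralizer x" using gc by (simp add: centralizer_def)
qed

section \<open>Elements of prime power order\<close>

text \<open>The elements whose order is a power of \<open>r\<close>, the identity included.\<close>

definition prime_power_torsion :: "nat \<Rightarrow> 'a \<Rightarrow> bool" where
  "prime_power_torsion r x \<longleftrightarrow> x \<in> carrier G \<and> (\<exists>e. x [^] (r ^ e) = \<one>)"

text \<open>An element is a product of powers of itself that have prime power order, so if all of these are central
then so is the element. The induction splits an exponent \<open>n\<close> that annihilates \<open>x\<close> into coprime factors.\<close>

lemma pow_noncentral_primary:
  assumes "x \<in> carrier G" "class_size x \<noteq> 1"
  shows "\<exists>(m::nat) r. prime r \<and> class_size (x [^] m) \<noteq> 1 \<and> prime_power_torsion r (x [^] m)"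
proof -
  have "n > 0 \<Longrightarrow> x [^] n = \<one> \<Longrightarrow> x \<in> carrier G \<Longrightarrow> class_size x \<noteq> 1 \<Longrightarrow>
    \<exists>(m::nat) r. prime r \<and> class_size (x [^] m) \<noteq> 1 \<and> prime_power_torsion r (x [^] m)" for n :: nat and x
  proof (induction n arbitrary: x rule: less_induct)
    case (less n)
    have "n \<noteq> 1"
    proof
      assume "n = 1"
      then have "x = \<one>" using less.prems by simp
      then have "centralizer x = carrier G" by (auto simp: centralizer_def)
      then show False using less.prems class_size_eq_1_iff by blast
    qed
    then obtain r where r: "prime r" "r dvd n" using prime_factor_nat by blast
    \<comment> \<open>the coprime factors are the full power of \<open>r\<close> in \<open>n\<close> and its cofactor\<close>
    obtain v where v: "n = r ^ multiplicity r n * v" "\<not> r dvd v"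
      using multiplicity_decompose'[of n r] less.prems(1) r by (metis gr_implies_not0 not_prime_unit)
    define u where "u = r ^ multiplicity r n"
    have mult: "multiplicity r n > 0" using r less.prems(1) by (simp add: prime_multiplicity_gt_zero_iff)
    show ?case
    proof (cases "v = 1")
      case True
      then have "prime_power_torsion r (x [^] (1::nat))"
        using less.prems v(1) by (auto simp: prime_power_torsion_def intro!: exI[of _ "multiplicity r n"])
      then show ?thesis using r less.prems by (intro exI[of _ "1::nat"] exI[of _ r]) simp
    next
      case False
      have cop: "coprime u v" unfolding u_def using r(1) v(2)
        by (simp add: prime_imp_coprime)
      have pos: "u > 0" "v > 0" using less.prems(1) v(1) by (auto simp: u_def intro!: gr0I)
      have "u \<noteq> 1" using mult prime_gt_1_nat[OF r(1)] by (auto simp: u_def)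
      then have lt: "u < n" "v < n" using False pos v(1) by (auto simp: u_def[symmetric])
      have killed: "(x [^] u) [^] v = \<one>" "(x [^] v) [^] u = \<one>"
        using less.prems v(1) by (simp_all add: nat_pow_pow u_def mult.commute)
      have "class_size (x [^] u) \<noteq> 1 \<or> class_size (x [^] v) \<noteq> 1"
      proof (rule ccontr)
        assume "\<not> ?thesis"
        then have "centralizer (x [^] u) = carrier G" "centralizer (x [^] v) = carrier G"
          using less.prems(3) class_size_eq_1_iff by auto
        then have "carrier G \<subseteq> centralizer x"
          using centralizer_pow_coprime[OF less.prems(3) cop False] by simp
        then have "centralizer x = carrier G" by (auto simp: centralizer_def)
        then show False using less.prems class_size_eq_1_iff by blast
      qed
      then obtain k :: nat where
        "\<exists>(m::nat) r. prime r \<and> class_size ((x [^] k) [^] m) \<noteq> 1 \<and> prime_power_torsion r ((x [^] k) [^] m)"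
        using less.IH[OF lt(2) pos(2) killed(1)] less.IH[OF lt(1) pos(1) killed(2)] less.prems(3)
        by auto
      then show ?thesis using less.prems(3) by (auto simp: nat_pow_pow)
    qed
  qed
  from this[of "order G" x] show ?thesis
    using assms pow_order_eq_1 order_gt_0_iff_finite by auto
qed

text \<open>The orbits of \<open>H\<close> on the class of \<open>y\<close> have \<open>p\<close>-power lengths, and the length of the class is prime to
\<open>p\<close>, so there is an orbit of length one.\<close>

lemma p_subgroup_centralizes_conjugate:
  assumes H: "subgroup H G" and card_H: "card H = p ^ k" and p: "prime p"
    and y: "y \<in> carrier G" and ndvd: "\<not> p dvd class_size y"
  shows "\<exists>z\<in>conj_class G y. \<forall>h\<in>H. h \<otimes> z = z \<otimes> h"
proof (rule ccontr)
  assume no_fixed: "\<not> ?thesis"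
  note Hc = subgroup.mem_carrier[OF H] subgroup.m_closed[OF H] subgroup.m_inv_closed[OF H]
  define Orb where "Orb z = (\<lambda>h. cj h z) ` H" for z
  have self: "z \<in> Orb z" if "z \<in> carrier G" for z
    using that subgroup.one_closed[OF H] by (auto simp: Orb_def intro!: image_eqI[of _ _ \<one>])
  have sub: "Orb z \<subseteq> conj_class G y" if "z \<in> conj_class G y" for z
    using that y Hc(1) by (auto simp: Orb_def conj_class_eq cj_cj)
  have dvd_orb: "p dvd card (Orb z)" if z: "z \<in> conj_class G y" for z
  proof -
    have zc: "z \<in> carrier G" using z conj_class_subset y by blast
    have "card (Orb z) * card (H \<inter> centralizer z) = card H"
      unfolding Orb_def
    proof (rule card_image_times_fibre_subgroup[OF H])
      show "subgroup (H \<inter> centralizer z) G"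
        using H subgroup_centralizer[OF zc] subgroups_Inter_pair by blast
    qed (use zc Hc cj_eq_iff in auto)
    then have "card (Orb z) dvd p ^ k" using card_H by (metis dvd_triv_left)
    then obtain i where i: "card (Orb z) = p ^ i" using p divides_primepow_nat by blast
    moreover have "i \<noteq> 0"
    proof
      assume "i = 0"
      then obtain w where "Orb z = {w}" using i card_1_singletonE by auto
      then have "Orb z = {z}" using self[OF zc] by auto
      then have "cj h z = z" if "h \<in> H" for h using that by (auto simp: Orb_def)
      then have "h \<otimes> z = z \<otimes> h" if "h \<in> H" for h
        using that Hc(1) zc by (metis inv_solve_right' m_closed)
      then show False using no_fixed z by blast
    qed
    ultimately show ?thesis by simp
  qed
  have same: "Orb w = Orb z" if z: "z \<in> carrier G" and w: "w \<in> Orb z" for w z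
  proof -
    obtain g where g: "g \<in> H" "w = cj g z" using w by (auto simp: Orb_def)
    have "Orb w \<subseteq> Orb z" using g Hc z by (auto simp: Orb_def cj_cj)
    moreover have "cj h z \<in> Orb w" if h: "h \<in> H" for h
    proof -
      have "cj h z = cj (h \<otimes> inv g) w" using g h Hc z
        by (simp add: cj_cj inv_mult_group m_assoc)
      then show ?thesis using g h Hc by (auto simp: Orb_def)
    qed
    ultimately show ?thesis by (auto simp: Orb_def)
  qed
  have un: "\<Union>(Orb ` conj_class G y) = conj_class G y"
    using sub self conj_class_subset[OF y] by blast
  have "p dvd card (\<Union>(Orb ` conj_class G y))"
  proof (rule dvd_partition)
    show "\<forall>c1\<in>Orb ` conj_class G y. \<forall>c2\<in>Orb ` conj_class G y. c1 \<noteq> c2 \<longrightarrow> c1 \<inter> c2 = {}"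
      using same conj_class_subset[OF y] by blast
  qed (use un finite_class y dvd_orb in auto)
  then show False using ndvd un by simp
qed

text \<open>This is how elements attached to different primes are made to commute: the cyclic group generated by
\<open>t\<close> fixes a point in the class of \<open>y\<close>.\<close>

lemma commutes_with_conjugate:
  assumes t: "prime_power_torsion r t" and r: "prime r"
    and y: "y \<in> carrier G" and ndvd: "\<not> r dvd class_size y"
  shows "\<exists>z\<in>conj_class G y. t \<otimes> z = z \<otimes> t"
proof -
  obtain e where e: "t \<in> carrier G" "t [^] (r ^ e) = \<one>"
    using t by (auto simp: prime_power_torsion_def)
  then have "ord t dvd r ^ e" using pow_eq_id by blast
  then obtain k where "ord t = r ^ k" using r divides_primepow_nat by blast
  then have "card (generate G {t}) = r ^ k" using e generate_pow_card by simp
  moreover have "subgroup (generate G {t}) G" using e generate_is_subgroup by blast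
  moreover have "t \<in> generate G {t}" by (simp add: generate.incl)
  ultimately show ?thesis using p_subgroup_centralizes_conjugate r y ndvd by metis
qed

text \<open>Replacing an element by a conjugate changes none of the data used below.\<close>

lemma conjugates:
  assumes "x \<in> carrier G" "z \<in> conj_class G x"
  shows "z \<in> carrier G" "conj_class G z = conj_class G x"
    "prime_power_torsion r x \<Longrightarrow> prime_power_torsion r z"
proof -
  obtain g where g: "g \<in> carrier G" "z = cj g x" using assms by (auto simp: conj_class_eq)
  then show "z \<in> carrier G" "conj_class G z = conj_class G x" using assms class_cj by auto
  assume "prime_power_torsion r x"
  then obtain e where "x [^] (r ^ e) = \<one>" by (auto simp: prime_power_torsion_def)
  then have "z [^] (r ^ e) = \<one>" using cj_pow[OF assms(1) g(1)] g by simp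
  then show "prime_power_torsion r z" using \<open>z \<in> carrier G\<close> by (auto simp: prime_power_torsion_def)
qed

section \<open>Two elements with coprime class sizes\<close>

text \<open>If \<open>x\<close> and \<open>y\<close> have coprime class sizes, then the index of the intersection of their centralizers is
divisible by both sizes, hence by their product. That index is the size of the orbit of the pair, which
therefore fills the whole product of the classes: the two elements can be conjugated independently.\<close>

lemma coprime_classes_simultaneous:
  assumes x: "x \<in> carrier G" and y: "y \<in> carrier G"
    and cop: "coprime (class_size x) (class_size y)"
  shows "(\<lambda>g. (cj g x, cj g y)) ` carrier G = conj_class G x \<times> conj_class G y"
    and "class_size x * class_size y * card (centralizer x \<inter> centralizer y) = order G"
proof -
  let ?f = "\<lambda>g. (cj g x, cj g y)" and ?S = "centralizer x \<inter> centralizer y"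
  have S: "subgroup ?S G" using subgroup_centralizer x y subgroups_Inter_pair by blast
  have eq: "card (?f ` carrier G) * card ?S = order G"
    unfolding order_def
  proof (rule card_image_times_fibre_subgroup[OF subgroup_self S])
    show "centralizer x \<inter> centralizer y \<subseteq> carrier G" by (auto simp: centralizer_def)
    show "(?f g = ?f h) = (inv h \<otimes> g \<in> centralizer x \<inter> centralizer y)"
      if "g \<in> carrier G" "h \<in> carrier G" for g h
      using cj_eq_iff[OF x that] cj_eq_iff[OF y that] by simp
  qed
  have "class_size x dvd card (?f ` carrier G)" "class_size y dvd card (?f ` carrier G)"
    using index_dvd[OF S subgroup_centralizer _ eq class_size_times_centralizer] x y by auto
  then have "class_size x * class_size y dvd card (?f ` carrier G)"
    using cop by (simp add: divides_mult)
  moreover have "card (?f ` carrier G) > 0" by (auto simp: card_gt_0_iff)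
  ultimately have ge: "class_size x * class_size y \<le> card (?f ` carrier G)"
    by (simp add: dvd_imp_le)
  show im: "?f ` carrier G = conj_class G x \<times> conj_class G y"
    by (rule card_seteq) (use ge x y finite_class cj_in_class in \<open>auto simp: card_cartesian_product\<close>)
  then show "class_size x * class_size y * card ?S = order G"
    using eq by (simp add: card_cartesian_product)
qed

text \<open>Since the factors can be conjugated independently, every product of conjugates is a simultaneous
conjugate of \<open>x \<otimes> y\<close>: the product of the two classes is a single class.\<close>

lemma coprime_classes_mult:
  assumes "x \<in> carrier G" "y \<in> carrier G" "coprime (class_size x) (class_size y)"
  shows "class_size (x \<otimes> y) dvd class_size x * class_size y"
    and "u \<in> conj_class G x \<Longrightarrow> v \<in> conj_class G y \<Longrightarrow> u \<otimes> v \<in> conj_class G (x \<otimes> y)"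
proof -
  have "centralizer x \<inter> centralizer y \<subseteq> centralizer (x \<otimes> y)"
  proof
    fix g assume "g \<in> centralizer x \<inter> centralizer y"
    then have g: "g \<in> carrier G" "g \<otimes> x = x \<otimes> g" "g \<otimes> y = y \<otimes> g" by (auto simp: centralizer_def)
    have "g \<otimes> (x \<otimes> y) = g \<otimes> x \<otimes> y" using g(1) assms(1,2) by (simp add: m_assoc)
    also have "\<dots> = x \<otimes> y \<otimes> g" using g assms(1,2) by (simp add: m_assoc)
    finally show "g \<in> centralizer (x \<otimes> y)" using g(1) by (simp add: centralizer_def)
  qed
  then show "class_size (x \<otimes> y) dvd class_size x * class_size y"
    using index_dvd[of "centralizer x \<inter> centralizer y" "centralizer (x \<otimes> y)"]
      coprime_classes_simultaneous(2)[OF assms] class_size_times_centralizer[of "x \<otimes> y"]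
      subgroup_centralizer subgroups_Inter_pair assms by simp
  assume "u \<in> conj_class G x" "v \<in> conj_class G y"
  then have "(u, v) \<in> (\<lambda>g. (cj g x, cj g y)) ` carrier G"
    using coprime_classes_simultaneous(1)[OF assms] by simp
  then obtain g where "g \<in> carrier G" "u = cj g x" "v = cj g y" by auto
  then show "u \<otimes> v \<in> conj_class G (x \<otimes> y)"
    using assms by (auto simp flip: cj_mult intro: cj_in_class)
qed

text \<open>The stabilizer acts freely on \<open>X\<close> by left multiplication, so \<open>X\<close> is a union of right cosets of it.\<close>

lemma left_stabilizer_subgroup:
  assumes X: "X \<subseteq> carrier G"
  shows "subgroup {g \<in> carrier G. \<forall>u\<in>X. g \<otimes> u \<in> X} G"
    and "card {g \<in> carrier G. \<forall>u\<in>X. g \<otimes> u \<in> X} dvd card X"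
proof -
  let ?M = "{g \<in> carrier G. \<forall>u\<in>X. g \<otimes> u \<in> X}"
  have finX: "finite X" using X finite_subset by blast
  show M: "subgroup ?M G"
  proof (rule subgroupI)
    show "?M \<noteq> {}" using X by (auto intro!: exI[of _ \<one>])
    show "a \<otimes> b \<in> ?M" if "a \<in> ?M" "b \<in> ?M" for a b
      using that X by (auto simp: m_assoc subset_iff)
    show "inv a \<in> ?M" if a: "a \<in> ?M" for a
    proof -
      have "(\<otimes>) a ` X \<subseteq> X" using a by blast
      moreover have "inj_on ((\<otimes>) a) X" using a X by (auto simp: inj_on_def subset_iff)
      ultimately have "(\<otimes>) a ` X = X" using endo_inj_surj[OF finX] by blast
      have "inv a \<otimes> u \<in> X" if "u \<in> X" for u
      proof -
        have "u \<in> (\<otimes>) a ` X" using that \<open>(\<otimes>) a ` X = X\<close> by simp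
        then obtain w where w: "w \<in> X" "u = a \<otimes> w" by (rule imageE)
        have "a \<in> carrier G" "w \<in> carrier G" using a w(1) X by blast+
        then show ?thesis using w by simp
      qed
      then show ?thesis using a by simp
    qed
  qed auto
  define M where "M = ?M"
  have M': "subgroup M G" using M by (simp add: M_def)
  have Mc: "M \<subseteq> carrier G" and MX: "\<And>m u. m \<in> M \<Longrightarrow> u \<in> X \<Longrightarrow> m \<otimes> u \<in> X"
    by (auto simp: M_def)
  have cosets: "(\<lambda>u. M #> u) ` X \<subseteq> rcosets M" using X Mc rcosetsI by blast
  have un: "\<Union>((\<lambda>u. M #> u) ` X) = X"
  proof
    show "\<Union>((\<lambda>u. M #> u) ` X) \<subseteq> X" using MX by (auto simp: r_coset_def)
    show "X \<subseteq> \<Union>((\<lambda>u. M #> u) ` X)" using X rcos_self[OF _ M'] by blast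
  qed
  have "card M dvd card (\<Union>((\<lambda>u. M #> u) ` X))"
  proof (rule dvd_partition)
    show "\<forall>c1\<in>(\<lambda>u. M #> u) ` X. \<forall>c2\<in>(\<lambda>u. M #> u) ` X. c1 \<noteq> c2 \<longrightarrow> c1 \<inter> c2 = {}"
      using rcos_disjoint[OF M'] cosets unfolding pairwise_def disjnt_def by blast
    show "\<forall>c\<in>(\<lambda>u. M #> u) ` X. card M dvd card c"
      using card_rcosets_equal[OF _ Mc] cosets by (metis dvd_refl subsetD)
    show "finite (\<Union>((\<lambda>u. M #> u) ` X))" by (subst un) (rule finX)
  qed
  then show "card ?M dvd card X" unfolding un by (simp add: M_def)
qed

text \<open>The main obstruction to be excluded is that the class size of \<open>x \<otimes> y\<close> loses the part coming from
\<open>y\<close>. Suppose it does. The class \<open>D\<close> of the product is then no larger than the class \<open>X\<close> of \<open>x\<close>, so each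
translate of \<open>X\<close> by a conjugate of \<open>y\<close> is all of \<open>D\<close>. Hence the conjugates of \<open>y\<close> all lie in one coset of
the left stabilizer \<open>M\<close> of \<open>X\<close>. Being the stabilizer of a class, \<open>M\<close> is normal, and its order divides
the \<open>p\<close>-power \<open>card X\<close>. A \<open>p\<close>-group centralizes some conjugate of \<open>y\<close>, so the normal subgroup \<open>M\<close>
centralizes \<open>y\<close> itself. Any conjugate of \<open>y\<close> is now \<open>y \<otimes> m\<close> with \<open>m \<in> M\<close> commuting with \<open>y\<close>; as the
order of \<open>y\<close> is a power of \<open>s \<noteq> p\<close>, the \<open>p\<close>-element \<open>m\<close> is trivial and \<open>y\<close> is central. The
condition \<open>s \<noteq> p\<close> cannot be dropped: when \<open>y\<close> is a \<open>p\<close>-element, the class of \<open>x\<close> may be a union of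
cosets of the subgroup generated by the commutators of \<open>y\<close>.\<close>

lemma class_size_mult_not_dvd:
  assumes x: "x \<in> carrier G" and p: "prime p" and size_x: "class_size x = p ^ a"
    and y: "prime_power_torsion s y" and s: "prime s" "s \<noteq> p"
    and nc: "class_size y \<noteq> 1" and ndvd: "\<not> p dvd class_size y"
  shows "\<not> class_size (x \<otimes> y) dvd class_size x"
proof
  assume dvd: "class_size (x \<otimes> y) dvd class_size x"
  have yc: "y \<in> carrier G" using y by (simp add: prime_power_torsion_def)
  have cop: "coprime (class_size y) (class_size x)"
    using ndvd p size_x by (metis coprime_commute coprime_power_left_iff prime_imp_coprime)
  define X where "X = conj_class G x"
  define D where "D = conj_class G (y \<otimes> x)"
  define M where "M = {g \<in> carrier G. \<forall>u\<in>X. g \<otimes> u \<in> X}"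
  have Xc: "X \<subseteq> carrier G" using x conj_class_subset by (simp add: X_def)
  have finD: "finite D" using x yc finite_class by (simp add: D_def)
  have cardD: "card D \<le> card X"
    using dvd class_size_mult_commute[OF x yc] class_size_pos[OF x]
    by (simp add: D_def X_def dvd_imp_le)
  have translate: "(\<otimes>) v ` X = D" if v: "v \<in> conj_class G y" for v
  proof (rule card_seteq[OF finD])
    show "(\<otimes>) v ` X \<subseteq> D"
      using coprime_classes_mult(2)[OF yc x cop v] by (simp add: X_def D_def image_subset_iff)
    have "inj_on ((\<otimes>) v) X"
      using Xc v conj_class_subset[OF yc] by (auto simp: inj_on_def subset_iff)
    then show "card D \<le> card ((\<otimes>) v ` X)" using cardD by (simp add: card_image)
  qed
  note M = left_stabilizer_subgroup[OF Xc, folded M_def]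
  obtain k where k: "card M = p ^ k"
    using M(2) p by (auto simp: X_def size_x divides_primepow_nat)
  have normal: "cj g m \<in> M" if m: "m \<in> M" and g: "g \<in> carrier G" for m g
  proof -
    have mc: "m \<in> carrier G" using m by (simp add: M_def)
    have cjX: "cj h u \<in> X" if "u \<in> X" "h \<in> carrier G" for u h
      using that x by (auto simp: X_def conj_class_eq cj_cj)
    have "cj g m \<otimes> u \<in> X" if u: "u \<in> X" for u
    proof -
      have uc: "u \<in> carrier G" using u Xc by blast
      have "m \<otimes> cj (inv g) u \<in> X" using m u g cjX[of u "inv g"] by (auto simp: M_def)
      then have "cj g (m \<otimes> cj (inv g) u) \<in> X" using g cjX by blast
      moreover have "cj g (m \<otimes> cj (inv g) u) = cj g m \<otimes> u"
        using mc uc g by (simp add: m_assoc)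
      ultimately show ?thesis by simp
    qed
    then show ?thesis using mc g by (simp add: M_def)
  qed
  obtain z where z: "z \<in> conj_class G y" "\<forall>m\<in>M. m \<otimes> z = z \<otimes> m"
    using p_subgroup_centralizes_conjugate[OF M(1) k p yc ndvd] by blast
  \<comment> \<open>normality of \<open>M\<close> moves the fixed point from \<open>z\<close> back to \<open>y\<close>\<close>
  obtain h where h: "h \<in> carrier G" "z = cj h y" using z yc by (auto simp: conj_class_eq)
  have commute: "m \<otimes> y = y \<otimes> m" if m: "m \<in> M" for m
  proof -
    have mc: "m \<in> carrier G" using m by (simp add: M_def)
    have "cj h m \<otimes> cj h y = cj h y \<otimes> cj h m" using z normal[OF m h(1)] h(2) by simp
    then have "cj h (m \<otimes> y) = cj h (y \<otimes> m)" using mc yc h(1) by (simp only: cj_mult)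
    then show ?thesis using mc yc h(1) by simp
  qed
  obtain e where e: "y [^] (s ^ e) = \<one>" using y by (auto simp: prime_power_torsion_def)
  have "cj g y = y" if g: "g \<in> carrier G" for g
  proof -
    define v where "v = cj g y"
    have vc: "v \<in> carrier G" using g yc by (simp add: v_def)
    have v: "v \<in> conj_class G y" using g yc cj_in_class by (simp add: v_def)
    define m where "m = inv y \<otimes> v"
    have mc: "m \<in> carrier G" using yc vc by (simp add: m_def)
    have vm: "v = y \<otimes> m" using yc vc by (simp add: m_def)
    have "m \<in> M"
    proof -
      have "m \<otimes> u \<in> X" if u: "u \<in> X" for u
      proof -
        have "v \<otimes> u \<in> (\<otimes>) y ` X"
          using u translate[OF v] translate[OF self_in_class[OF yc]] by blast
        then obtain w where w: "w \<in> X" "v \<otimes> u = y \<otimes> w" by auto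
        have "m \<otimes> u = inv y \<otimes> (v \<otimes> u)" using u Xc yc vc by (auto simp: m_def m_assoc)
        then show ?thesis using w Xc yc by auto
      qed
      then show ?thesis using mc by (simp add: M_def)
    qed
    have "v [^] (s ^ e) = \<one>" using e g yc by (simp add: v_def cj_pow)
    then have "m [^] (s ^ e) = \<one>"
      using pow_mult_distrib[OF commute[OF \<open>m \<in> M\<close>, symmetric] yc mc] vm e mc by simp
    then have "ord m dvd s ^ e" using mc pow_eq_id by blast
    moreover have "ord m dvd p ^ k"
    proof -
      have "generate G {m} \<subseteq> M" using generate_subgroup_incl[OF _ M(1)] \<open>m \<in> M\<close> by simp
      then have "card (generate G {m}) dvd card M"
        using card_subgroup_dvd M(1) generate_is_subgroup mc by simp
      then show ?thesis using generate_pow_card[OF mc] k by simp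
    qed
    moreover have "coprime (s ^ e) (p ^ k)" using s p by (simp add: primes_coprime)
    ultimately have "ord m = 1" using coprime_common_divisor_nat by blast
    then have "m = \<one>" using mc ord_eq_1 by blast
    then show ?thesis using vm yc by (simp add: v_def)
  qed
  then have "conj_class G y = {y}" using yc by (auto simp: conj_class_eq)
  then show False using nc by simp
qed

text \<open>For commuting elements of coprime orders, \<open>x\<close> is a power of \<open>x \<otimes> y\<close>.\<close>

lemma class_size_dvd_mult_coprime_orders:
  assumes x: "prime_power_torsion r x" and y: "prime_power_torsion s y"
    and rs: "prime r" "prime s" "r \<noteq> s" and comm: "x \<otimes> y = y \<otimes> x"
  shows "class_size x dvd class_size (x \<otimes> y)"
proof -
  obtain e where e: "x \<in> carrier G" "x [^] (r ^ e) = \<one>"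
    using x by (auto simp: prime_power_torsion_def)
  obtain f where f: "y \<in> carrier G" "y [^] (s ^ f) = \<one>"
    using y by (auto simp: prime_power_torsion_def)
  \<comment> \<open>\<open>Suc e\<close> instead of \<open>e\<close> keeps the modulus different from 1, also when \<open>x\<close> is the identity\<close>
  have "coprime (s ^ f) (r ^ Suc e)" using rs by (simp add: primes_coprime)
  moreover have "r ^ Suc e \<noteq> 1" using prime_gt_1_nat[OF rs(1)] by (metis nat.distinct(1) nat_power_eq_Suc_0_iff One_nat_def less_irrefl)
  ultimately obtain i j where ij: "s ^ f * i = r ^ Suc e * j + 1"
    using coprime_bezout_strong by blast
  have "(x \<otimes> y) [^] (s ^ f * i) = x [^] (s ^ f * i) \<otimes> y [^] (s ^ f * i)"
    using pow_mult_distrib[OF comm] e f by simp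
  also have "y [^] (s ^ f * i) = \<one>" using f by (simp flip: nat_pow_pow)
  also have "x [^] (s ^ f * i) = (x [^] (r ^ e)) [^] (r * j) \<otimes> x"
    using e(1) unfolding ij by (simp add: nat_pow_pow mult.assoc mult.left_commute)
  finally have "(x \<otimes> y) [^] (s ^ f * i) = x" using e by simp
  then show ?thesis using class_size_pow_dvd[of "x \<otimes> y" "s ^ f * i"] e f by simp
qed

text \<open>If \<open>r\<close> does not divide the class size of \<open>y\<close>, some conjugate of \<open>y\<close> commutes with \<open>x\<close>; as the orders are
coprime, the product retains both class sizes as divisors.\<close>

lemma mult_coprime_orders:
  assumes x: "prime_power_torsion r x" and y: "prime_power_torsion s y"
    and rs: "prime r" "prime s" "r \<noteq> s" and ndvd: "\<not> r dvd class_size y"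
  shows "\<exists>z\<in>conj_class G y. class_size x dvd class_size (x \<otimes> z) \<and> class_size y dvd class_size (x \<otimes> z)"
proof -
  have yc: "y \<in> carrier G" using y by (simp add: prime_power_torsion_def)
  have xc: "x \<in> carrier G" using x by (simp add: prime_power_torsion_def)
  obtain z where z: "z \<in> conj_class G y" "x \<otimes> z = z \<otimes> x"
    using commutes_with_conjugate[OF x rs(1) yc ndvd] by blast
  note zy = conjugates[OF yc z(1)]
  have "class_size x dvd class_size (x \<otimes> z)"
    using class_size_dvd_mult_coprime_orders[OF x zy(3)[OF y] rs z(2)] .
  moreover have "class_size y dvd class_size (x \<otimes> z)"
    using class_size_dvd_mult_coprime_orders[OF zy(3)[OF y] x rs(2,1)] rs(3) z(2) zy(2) by simp
  ultimately show ?thesis using z(1) by blast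
qed

end

section \<open>Class sizes with exactly two prime divisors\<close>

lemma prime_factors_two_primes:
  fixes n p q :: nat
  assumes "prime p" "prime q" "p dvd n" "q dvd n" "n dvd p ^ a * q ^ b"
  shows "prime_factors n = {p, q}"
proof -
  have "n > 0" using assms(1,2,5) by (intro gr0I) (auto dest: prime_gt_0_nat)
  moreover have "l = p \<or> l = q" if "prime l" "l dvd n" for l
    using that assms by (meson dvd_trans prime_dvd_mult_iff prime_dvd_power primes_dvd_imp_eq)
  ultimately show ?thesis using assms by (auto simp: prime_factors_dvd)
qed

lemma dvd_prime_power_mult_cases:
  fixes n p q :: nat
  assumes "prime q" "n dvd p ^ a * q ^ b" "\<not> n dvd p ^ a"
  shows "q dvd n"
proof (rule ccontr)
  assume "\<not> q dvd n"
  then have "coprime n (q ^ b)" using assms(1) by (metis coprime_commute coprime_power_right_iff prime_imp_coprime)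
  then show False using assms(2,3) coprime_dvd_mult_left_iff by blast
qed

context finite_group begin

text \<open>If all elements of \<open>q\<close>-power order are central, the centralizer of \<open>y\<close> contains a Sylow \<open>q\<close>-subgroup,
and then the class size of \<open>y\<close> is prime to \<open>q\<close>.\<close>

lemma exists_noncentral_primary:
  assumes q: "prime q" and y: "y \<in> carrier G" "q dvd class_size y"
  shows "\<exists>t. prime_power_torsion q t \<and> class_size t \<noteq> 1"
proof (rule ccontr)
  assume none: "\<not> ?thesis"
  have pos: "order G > 0" using order_gt_0_iff_finite by simp
  obtain m k where k: "order G = q ^ m * k" "\<not> q dvd k"
    using multiplicity_decompose'[of "order G" q] pos q by (metis gr_implies_not0 not_prime_unit)
  obtain P where P: "subgroup P G" "card P = q ^ m"
    using sylow_thm[OF q is_group k(1) finite_carrier] by blast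
  have "P \<subseteq> centralizer y"
  proof
    fix t assume t: "t \<in> P"
    then have tc: "t \<in> carrier G" by (rule subgroup.mem_carrier[OF P(1)])
    have "generate G {t} \<subseteq> P" using generate_subgroup_incl[OF _ P(1)] t by simp
    then have "card (generate G {t}) dvd card P"
      using card_subgroup_dvd P(1) generate_is_subgroup tc by simp
    then have "t [^] card P = \<one>" using pow_eq_id[OF tc] generate_pow_card[OF tc] by simp
    then have "prime_power_torsion q t" using tc P(2) by (auto simp: prime_power_torsion_def)
    then have "centralizer t = carrier G" using none tc class_size_eq_1_iff by blast
    then have "y \<in> centralizer t" using y by simp
    then show "t \<in> centralizer y" using tc by (simp add: centralizer_def)
  qed
  then have "card P dvd card (centralizer y)"
    using card_subgroup_dvd P(1) subgroup_centralizer y(1) by simp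
  then have "q * q ^ m dvd class_size y * card (centralizer y)"
    using y(2) P(2) by (intro mult_dvd_mono) simp_all
  then have "q ^ m * q dvd q ^ m * k"
    using class_size_times_centralizer[OF y(1)] k(1) by (simp add: mult.commute)
  then show False using k(2) prime_gt_0_nat[OF q] by (simp add: dvd_times_left_cancel_iff)
qed

text \<open>The configurations excluded by the last assumption are \<open>r = q, s = p\<close>, and \<open>r = s\<close> equal to \<open>p\<close> or to
\<open>q\<close>. In all others one of two mechanisms applies. If \<open>r \<noteq> q\<close> and \<open>s \<noteq> p\<close>, neither class size can
disappear from the product \<open>x \<otimes> y\<close>, by \<open>class_size_mult_not_dvd\<close> used twice. If \<open>r \<noteq> s\<close> and one of
\<open>r \<noteq> q\<close>, \<open>s \<noteq> p\<close> holds, then after conjugation \<open>x\<close> and \<open>y\<close> commute and have coprime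
orders.\<close>

lemma two_prime_class_size:
  assumes p: "prime p" and q: "prime q" "p \<noteq> q" and r: "prime r" and s: "prime s"
    and x: "prime_power_torsion r x" "class_size x = p ^ a" "a > 0"
    and y: "prime_power_torsion s y" "class_size y = q ^ b" "b > 0"
    and good: "\<not> ((r = q \<or> s = p) \<and> (r = s \<or> r = q \<and> s = p))"
  shows "\<exists>z\<in>carrier G. prime_factors (class_size z) = {p, q}"
proof -
  have xc: "x \<in> carrier G" and yc: "y \<in> carrier G"
    using x y by (simp_all add: prime_power_torsion_def)
  have cop: "coprime (class_size x) (class_size y)"
    using p q x y by (simp add: primes_coprime)
  have ndvd: "l dvd class_size x \<Longrightarrow> l = p" "l dvd class_size y \<Longrightarrow> l = q" if "prime l" for l
    using that x y p q by (metis prime_dvd_power primes_dvd_imp_eq)+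
  have dvd: "p dvd class_size x" "q dvd class_size y" using x y by simp_all
  have nc: "class_size x \<noteq> 1" "class_size y \<noteq> 1"
    using dvd p q(1) not_prime_unit[of p] not_prime_unit[of q] by auto
  have conclude: ?thesis if "u \<in> conj_class G x" "v \<in> conj_class G y"
    "p dvd class_size (u \<otimes> v)" "q dvd class_size (u \<otimes> v)" for u v
  proof -
    note u = conjugates[OF xc that(1)] and v = conjugates[OF yc that(2)]
    have "class_size (u \<otimes> v) dvd p ^ a * q ^ b"
      using coprime_classes_mult(1)[of u v] u v cop x y by simp
    then show ?thesis
      using prime_factors_two_primes[OF p q(1) that(3,4)] u(1) v(1) by blast
  qed
  consider "r \<noteq> q" "s \<noteq> p" | "r \<noteq> s" "r \<noteq> q" | "r \<noteq> s" "s \<noteq> p" using good by blast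
  then show ?thesis
  proof cases
    case 1
    have "class_size (x \<otimes> y) dvd p ^ a * q ^ b"
      using coprime_classes_mult(1)[OF xc yc cop] x y by simp
    moreover have "\<not> class_size (x \<otimes> y) dvd p ^ a"
      using class_size_mult_not_dvd[OF xc p x(2) y(1) s 1(2) nc(2)] ndvd(2)[OF p] q(2) x(2) by auto
    moreover have "\<not> class_size (x \<otimes> y) dvd q ^ b"
      using class_size_mult_not_dvd[OF yc q(1) y(2) x(1) r 1(1) nc(1)] ndvd(1)[OF q(1)] q(2) y(2)
        class_size_mult_commute[OF xc yc] by auto
    ultimately have "q dvd class_size (x \<otimes> y)" "p dvd class_size (x \<otimes> y)"
      using dvd_prime_power_mult_cases p q(1) by (metis mult.commute)+
    then show ?thesis using conclude self_in_class xc yc by blast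
  next
    case 2
    then obtain z where "z \<in> conj_class G y"
      "class_size x dvd class_size (x \<otimes> z)" "class_size y dvd class_size (x \<otimes> z)"
      using mult_coprime_orders[OF x(1) y(1) r s] ndvd(2)[OF r] by blast
    then show ?thesis using conclude[of x z] self_in_class[OF xc] dvd dvd_trans by blast
  next
    case 3
    then obtain z where z: "z \<in> conj_class G x"
      "class_size y dvd class_size (y \<otimes> z)" "class_size x dvd class_size (y \<otimes> z)"
      using mult_coprime_orders[OF y(1) x(1) s r] ndvd(1)[OF s] by blast
    then have "class_size (y \<otimes> z) = class_size (z \<otimes> y)"
      using class_size_mult_commute[OF yc conjugates(1)[OF xc z(1)]] by simp
    then show ?thesis using conclude[of z y] self_in_class[OF yc] z dvd dvd_trans by metis
  qed
qed

text \<open>This supplies one more class size in the situation where all chosen elements are \<open>p\<close>-elements and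
\<open>p\<close> itself occurs, so that no pair containing \<open>p\<close> is covered by \<open>two_prime_class_size\<close>. A
noncentral element \<open>t\<close> of \<open>q2\<close>-power order commutes with conjugates of both \<open>x\<close> and \<open>y\<close>. If the class
size of \<open>t\<close> has a prime divisor other than \<open>p\<close>, then \<open>x\<close> contributes the factor \<open>p\<close> to the
product with \<open>t\<close>. Otherwise \<open>t\<close> contributes \<open>p\<close> and \<open>y\<close> contributes \<open>q1\<close>.\<close>

lemma exists_class_size_divisible_by_star_centre:
  assumes p: "prime p" and q: "prime q1" "prime q2" and ne: "q1 \<noteq> p" "q2 \<noteq> p" "q1 \<noteq> q2"
    and x: "prime_power_torsion p x" "class_size x = p ^ a" "a > 0"
    and y: "prime_power_torsion p y" "class_size y = q1 ^ b" "b > 0"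
    and w: "w \<in> carrier G" "q2 dvd class_size w"
  shows "\<exists>z\<in>carrier G. p dvd class_size z \<and> (\<exists>l. prime l \<and> l \<noteq> p \<and> l dvd class_size z)"
proof -
  have xc: "x \<in> carrier G" and yc: "y \<in> carrier G"
    using x y by (simp_all add: prime_power_torsion_def)
  obtain t where t: "prime_power_torsion q2 t" "class_size t \<noteq> 1"
    using exists_noncentral_primary[OF q(2) w] by blast
  have tc: "t \<in> carrier G" using t by (simp add: prime_power_torsion_def)
  have "\<not> q2 dvd class_size x" "\<not> q2 dvd class_size y"
    using x y p q ne by (metis prime_dvd_power primes_dvd_imp_eq)+
  then obtain u v where u: "u \<in> conj_class G x"
      "class_size t dvd class_size (t \<otimes> u)" "class_size x dvd class_size (t \<otimes> u)"
    and v: "v \<in> conj_class G y"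
      "class_size t dvd class_size (t \<otimes> v)" "class_size y dvd class_size (t \<otimes> v)"
    using mult_coprime_orders[OF t(1) x(1) q(2) p ne(2)] mult_coprime_orders[OF t(1) y(1) q(2) p ne(2)]
    by blast
  have uv: "t \<otimes> u \<in> carrier G" "t \<otimes> v \<in> carrier G"
    using u v xc yc tc conjugates(1) by blast+
  have dvd: "p dvd class_size (t \<otimes> u)" "q1 dvd class_size (t \<otimes> v)"
    using u(3) v(3) x y by (auto intro: dvd_trans[OF dvd_power])
  obtain l where l: "prime l" "l dvd class_size t" using t(2) prime_factor_nat by blast
  show ?thesis
  proof (cases "l = p")
    case True
    then show ?thesis using l v dvd q ne uv by (metis dvd_trans)
  next
    case False
    then show ?thesis using l u dvd uv by (metis dvd_trans)
  qed
qed

end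

section \<open>Counting exceptional pairs\<close>

text \<open>For primes \<open>p\<close>, \<open>q\<close> whose chosen elements have orders that are powers of \<open>f p\<close>, \<open>f q\<close>, these are the
configurations in which \<open>two_prime_class_size\<close> gives no information.\<close>

definition exceptional :: "(nat \<Rightarrow> nat) \<Rightarrow> nat \<Rightarrow> nat \<Rightarrow> bool" where
  "exceptional f p q \<longleftrightarrow> (f p = q \<or> f q = p) \<and> (f p = f q \<or> f p = q \<and> f q = p)"

text \<open>The exceptional pairs are edges \<open>{q, f q}\<close> of the functional graph of \<open>f\<close>, and they form a disjoint
union of stars (around fixed points of \<open>f\<close>) and of single edges (cycles of length two). A star or a
single edge has one edge fewer than it has vertices, so the number of exceptional pairs is at most
\<open>card K - 2\<close> unless a single star covers \<open>K\<close>. Formally, \<open>L\<close> collects one leaf for each edge (in a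
two-cycle, the smaller vertex), and \<open>f\<close> maps \<open>L\<close> into its complement.\<close>

lemma few_exceptional_pairs:
  fixes K :: "nat set" and f :: "nat \<Rightarrow> nat"
  assumes fin: "finite K" and card: "card K \<ge> 3"
  defines "B \<equiv> {{p, q} | p q. p \<in> K \<and> q \<in> K \<and> p \<noteq> q \<and> exceptional f p q}"
  shows "card B + 2 \<le> card K \<or> (card B + 1 \<le> card K \<and> (\<exists>p\<in>K. \<forall>q\<in>K. f q = p))"
proof -
  \<comment> \<open>an edge of a two-cycle arises from both of its ends; the order on \<open>nat\<close> selects one of them\<close>
  define L where "L = {q \<in> K. f q \<in> K \<and> f q \<noteq> q \<and> (f (f q) = f q \<or> f (f q) = q \<and> q < f q)}"
  have finL: "finite L" and LK: "L \<subseteq> K" using fin by (auto simp: L_def)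
  have leaf: "\<exists>q\<in>L. {u, v} = {q, f q}"
    if "u \<in> K" "v \<in> K" "u \<noteq> v" "exceptional f u v" for u v
  proof (cases "f u = v \<and> (f v = v \<or> u < v)")
    case True
    then show ?thesis using that by (intro bexI[of _ u]) (auto simp: L_def exceptional_def)
  next
    case False
    then show ?thesis using that by (intro bexI[of _ v]) (auto simp: L_def exceptional_def)
  qed
  have "B \<subseteq> (\<lambda>q. {q, f q}) ` L" using leaf by (auto simp: B_def image_iff)
  then have BL: "card B \<le> card L"
    using finL by (meson card_image_le card_mono finite_imageI le_trans)
  have out: "f q \<in> K - L" if "q \<in> L" for q
    using that by (auto simp: L_def)
  have cardKL: "card (K - L) + card L = card K"
    using LK fin finL by (metis card_Diff_subset card_mono le_add_diff_inverse2)
  show ?thesis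
  proof (cases "card (K - L) \<ge> 2")
    case True
    then show ?thesis using cardKL BL by linarith
  next
    case False
    then have "card L \<ge> 2" using card cardKL by linarith
    then obtain q q' where q: "q \<in> L" "q' \<in> L" "q \<noteq> q'"
      by (metis card_le_Suc0_iff_eq finL not_less_eq_eq numeral_2_eq_2)
    have "card (K - L) \<noteq> 0" using out[OF q(1)] fin by auto
    then have "card (K - L) = 1" using False by linarith
    then obtain p where p: "K - L = {p}" using card_1_singletonE by blast
    then have fL: "f u = p" if "u \<in> L" for u using out[OF that] by auto
    have "f p = p" using q fL[OF q(1)] fL[OF q(2)] by (auto simp: L_def)
    have "f u = p" if "u \<in> K" for u
    proof (cases "u \<in> L")
      case False
      then have "u \<in> K - L" using that by simp
      then have "u = p" unfolding p by simp
      then show ?thesis using \<open>f p = p\<close> by simp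
    qed (rule fL)
    moreover have "p \<in> K" using p by blast
    moreover have "card B + 1 \<le> card K" using BL cardKL \<open>card (K - L) = 1\<close> by linarith
    ultimately show ?thesis by blast
  qed
qed

context finite_group begin

section \<open>The number of class sizes that are not prime powers\<close>

lemma cs_nppI:
  assumes "z \<in> carrier G" "prime p" "prime q" "p \<noteq> q" "p dvd class_size z" "q dvd class_size z"
  shows "class_size z \<in> cs_npp G"
proof -
  have "\<not> primepow (class_size z)"
    using assms by (metis primepow_def prime_dvd_power primes_dvd_imp_eq)
  moreover have "class_size z \<noteq> 1" using assms(2,5) by (metis nat_dvd_1_iff_1 not_prime_1)
  ultimately show ?thesis using assms(1) by (auto simp: cs_npp_def cs_def)
qed

text \<open>The class size of a power of an element divides that of the element, so a noncentral primary part of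
an element of \<open>p\<close>-power class size still has nontrivial \<open>p\<close>-power class size.\<close>

lemma cs_pp_primary:
  assumes "p \<in> cs_pp G"
  shows "\<exists>x r a. prime r \<and> prime_power_torsion r x \<and> class_size x = p ^ a \<and> a > 0"
proof -
  have p: "prime p" and "\<exists>a\<ge>1. p ^ a \<in> class_size ` carrier G"
    using assms by (simp_all add: cs_pp_def cs_def)
  then obtain x a where x: "x \<in> carrier G" "class_size x = p ^ a" "a \<ge> 1"
    by (metis imageE)
  have "class_size x \<noteq> 1" using x(2,3) prime_gt_1_nat[OF p] by simp
  then obtain m :: nat and r where m: "prime r" "class_size (x [^] m) \<noteq> 1" "prime_power_torsion r (x [^] m)"
    using pow_noncentral_primary x(1) by blast
  have "class_size (x [^] m) dvd p ^ a" using class_size_pow_dvd x by metis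
  then obtain i where "class_size (x [^] m) = p ^ i" using p divides_primepow_nat by blast
  then show ?thesis using m by (metis gr0I power_0)
qed

text \<open>With \<open>k\<close> primes, the nonexceptional pairs give class sizes with different sets of prime divisors. There
are at least \<open>(k choose 2) - (k - 2)\<close> such pairs, or else one fewer when the exceptional pairs form a star;
the class size divisible by the centre of the star then makes up for the missing one.\<close>

lemma card_cs_npp_ge:
  assumes fin: "finite (cs_pp G)" and card: "card (cs_pp G) \<ge> 3"
  shows "(card (cs_pp G) choose 2) + 2 \<le> card (cs_npp G) + card (cs_pp G)"
proof -
  define K where "K = cs_pp G"
  have K_prime: "prime p" if "p \<in> K" for p using that by (simp add: K_def cs_pp_def)
  have "\<forall>p\<in>K. \<exists>x r a. prime r \<and> prime_power_torsion r x \<and> class_size x = p ^ a \<and> a > 0"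
    unfolding K_def by (blast intro: cs_pp_primary)
  from bchoice[OF this] obtain X where
    "\<forall>p\<in>K. \<exists>r a. prime r \<and> prime_power_torsion r (X p) \<and> class_size (X p) = p ^ a \<and> a > 0"
    by blast
  from bchoice[OF this] obtain f where
    "\<forall>p\<in>K. \<exists>a. prime (f p) \<and> prime_power_torsion (f p) (X p) \<and> class_size (X p) = p ^ a \<and> a > 0"
    by blast
  from bchoice[OF this] obtain \<alpha> where X:
    "\<And>p. p \<in> K \<Longrightarrow> prime (f p)" "\<And>p. p \<in> K \<Longrightarrow> prime_power_torsion (f p) (X p)"
    "\<And>p. p \<in> K \<Longrightarrow> class_size (X p) = p ^ \<alpha> p" "\<And>p. p \<in> K \<Longrightarrow> \<alpha> p > 0"
    by blast
  define B where "B = {{p, q} | p q. p \<in> K \<and> q \<in> K \<and> p \<noteq> q \<and> exceptional f p q}"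
  define pairs where "pairs = {e. e \<subseteq> K \<and> card e = 2}"
  have finK: "finite K" using fin by (simp add: K_def)
  have fin_npp: "finite (cs_npp G)" by (simp add: cs_npp_def cs_def)
  have fin_pairs: "finite pairs" using finK by (simp add: pairs_def)
  have B_pairs: "B \<subseteq> pairs" by (auto simp: B_def pairs_def)
  have good: "pairs - B \<subseteq> prime_factors ` cs_npp G"
  proof
    fix e assume e: "e \<in> pairs - B"
    then obtain p q where pq: "e = {p, q}" "p \<noteq> q" "p \<in> K" "q \<in> K"
      by (auto simp: pairs_def card_2_iff)
    have "\<not> exceptional f p q" using e pq by (auto simp: B_def)
    then have "\<not> ((f p = q \<or> f q = p) \<and> (f p = f q \<or> f p = q \<and> f q = p))"
      by (simp add: exceptional_def)
    from two_prime_class_size[OF K_prime K_prime pq(2) X(1) X(1) X(2,3,4) X(2,3,4) this]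
    obtain z where z: "z \<in> carrier G" "prime_factors (class_size z) = {p, q}"
      using pq(3,4) by blast
    then have "p dvd class_size z" "q dvd class_size z" by auto
    then have "class_size z \<in> cs_npp G" using cs_nppI[OF z(1)] K_prime pq by blast
    then show "e \<in> prime_factors ` cs_npp G" using z(2) pq(1) by blast
  qed
  have card_good: "card (pairs - B) + card B = (card K choose 2)"
    using B_pairs fin_pairs n_subsets[OF finK, of 2]
    by (metis card_Diff_subset card_mono finite_subset le_add_diff_inverse2 pairs_def)
  have le: "card S \<le> card (cs_npp G)" if "S \<subseteq> prime_factors ` cs_npp G" for S
    using that fin_npp by (meson card_image_le card_mono finite_imageI le_trans)
  consider "card B + 2 \<le> card K"
    | p where "card B + 1 \<le> card K" "p \<in> K" "\<forall>q\<in>K. f q = p"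
    using few_exceptional_pairs[OF finK, of f] card by (auto simp: B_def K_def)
  then have "(card K choose 2) + 2 \<le> card (cs_npp G) + card K"
  proof cases
    case 1
    then show ?thesis using le[OF good] card_good by linarith
  next
    case 2
    have "\<not> card (K - {p}) \<le> Suc 0" using card finK 2(2) by (simp add: K_def)
    then obtain q1 q2 where q: "q1 \<in> K" "q2 \<in> K" "q1 \<noteq> p" "q2 \<noteq> p" "q1 \<noteq> q2"
      using card_le_Suc0_iff_eq[of "K - {p}"] finK by blast
    have f: "f u = p" if "u \<in> K" for u using 2(3) that by simp
    have "q2 dvd class_size (X q2)" using X(3,4) q(2) by simp
    moreover have "X q2 \<in> carrier G" using X(2) q(2) by (simp add: prime_power_torsion_def)
    ultimately obtain z l where z: "z \<in> carrier G" "p dvd class_size z" "prime l" "l \<noteq> p" "l dvd class_size z"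
      using exists_class_size_divisible_by_star_centre[OF K_prime[OF 2(2)] K_prime[OF q(1)] K_prime[OF q(2)] q(3-5)
          X(2)[OF 2(2), unfolded f[OF 2(2)]] X(3,4)[OF 2(2)]
          X(2)[OF q(1), unfolded f[OF q(1)]] X(3,4)[OF q(1)]]
      by blast
    have npp: "class_size z \<in> cs_npp G" using cs_nppI[OF z(1), of p l] K_prime[OF 2(2)] z by auto
    \<comment> \<open>the size obtained from the star differs from the others: its prime divisors include \<open>p\<close>\<close>
    have "p \<in> prime_factors (class_size z)"
      using z K_prime[OF 2(2)] class_size_pos by (simp add: prime_factors_dvd)
    moreover have "p \<notin> e" if e: "e \<in> pairs - B" for e
    proof
      assume "p \<in> e"
      obtain u v where uv: "e = {u, v}" "u \<noteq> v" "u \<in> K" "v \<in> K"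
        using e by (auto simp: pairs_def card_2_iff)
      then have "f u = p" "f v = p" using f by blast+
      then have "exceptional f u v" using \<open>p \<in> e\<close> uv(1) by (auto simp: exceptional_def)
      then show False using e uv by (auto simp: B_def)
    qed
    ultimately have new: "prime_factors (class_size z) \<notin> pairs - B" by blast
    have "card (insert (prime_factors (class_size z)) (pairs - B)) \<le> card (cs_npp G)"
      by (rule le) (use good npp in auto)
    then have "card (pairs - B) + 1 \<le> card (cs_npp G)" using new fin_pairs by simp
    then show ?thesis using card_good 2(1) by linarith
  qed
  then show ?thesis by (simp add: K_def)
qed

end

text \<open>For \<open>k \<ge> 4\<close> the bound \<open>(k choose 2) - (k - 2)\<close> is at least \<open>k\<close>, with equality for \<open>k = 4\<close>, and for
\<open>k = 3\<close> it is two. The three claims follow by contraposition.\<close>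

theorem theorem2:
  fixes G :: "('a, 'b) monoid_scheme"
  assumes "group G" and "finite (carrier G)"
  shows "(\<forall>n. card (cs_npp G) = n \<and> n \<ge> 3 \<longrightarrow> card (cs_pp G) \<le> n)
       \<and> (card (cs_npp G) = 2 \<longrightarrow> card (cs_pp G) \<le> 3)
       \<and> (card (cs_npp G) = 1 \<longrightarrow> card (cs_pp G) \<le> 2)"
proof -
  interpret finite_group G
    using assms by (simp add: finite_group_def finite_group_axioms_def)
  define k where "k = card (cs_pp G)"
  define n where "n = card (cs_npp G)"
  have bound: "(k choose 2) + 2 \<le> n + k" if "k \<ge> 3"
    using that card_cs_npp_ge card.infinite[of "cs_pp G"] by (cases "finite (cs_pp G)") (auto simp: k_def n_def)
  have large: "k \<le> n" if "k \<ge> 4"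
  proof -
    have "2 * (k choose 2) = k * (k - 1)" by (cases k) (auto simp: choose_two)
    moreover have "4 * k \<le> k * (k - 1) + 4"
    proof -
      from le_Suc_ex[OF that] obtain j where "k = 4 + j" ..
      then show ?thesis by (simp add: algebra_simps)
    qed
    ultimately show ?thesis using bound that by linarith
  qed
  have three: "n \<ge> 2" if "k = 3" using bound that by (simp add: choose_two)
  have "(n \<ge> 3 \<longrightarrow> k \<le> n) \<and> (n = 2 \<longrightarrow> k \<le> 3) \<and> (n = 1 \<longrightarrow> k \<le> 2)"
    using large three by linarith
  then show ?thesis by (simp add: k_def n_def)
qed

end
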